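(* Let $k\ge 29/3$ be real. Then for $n\in\mathbb{N}$: (i) $R_n^{(k)}=p_n$ if and only if $1\le n\le \pi(2k)-1$; (ii) $R_n^{(k)}=p_{n+1}$ if and only if $\pi(2k)\le n\le\pi(3k)-2$.
   Context: $\mathbb{N}$ is the set of positive integers, $p_n$ is the $n$th prime number, and $\pi(x)$ is the number of primes $\le x$. For real $k>1$ and $n\in\mathbb{N}$, the $n$th $k$-Ramanujan prime is $R_n^{(k)}=\min\{m\in\mathbb{N} : \pi(x)-\pi(x/k)\ge n \text{ for every real } x\ge m\}$. *)

theory Defs
  imports Complex_Main "HOL-Library.Infinite_Set" "HOL-Computational_Algebra.Primes"
begin

definition prime_pi :: "real \<Rightarrow> nat" where
  "prime_pi x = card {p :: nat. prime p \<and> real p \<le> x}"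

text \<open>The primes are counted from 1 (so \<open>nth_prime 1 = 2\<close>), whereas \<^const>\<open>enumerate\<close>
  counts from 0; the value \<open>nth_prime 0\<close> is meaningless.\<close>

definition nth_prime :: "nat \<Rightarrow> nat" where
  "nth_prime n = enumerate {p. prime p} (n - 1)"

text \<open>The difference is taken in the integers to avoid truncated subtraction. For \<open>k > 1\<close>
  the minimum exists, since \<open>prime_pi x - prime_pi (x / k)\<close> tends to infinity with \<open>x\<close>.\<close>

definition ramanujan_prime :: "real \<Rightarrow> nat \<Rightarrow> nat" where
  "ramanujan_prime k n =
     (LEAST m :: nat. m \<ge> 1 \<and>
        (\<forall>x::real. x \<ge> real m \<longrightarrow> int (prime_pi x) - int (prime_pi (x / k)) \<ge> int n))"

end

theory Submission
  imports Defs "HOL-Number_Theory.Prime_Powers" "HOL-Analysis.Harmonic_Numbers"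
begin

text \<open>
  Write \<open>\<pi>\<close> for \<open>prime_pi\<close> and \<open>f x = \<pi>(x) - \<pi>(x / k)\<close>. On \<open>x < 2 * k\<close> nothing is subtracted, on
  \<open>2 * k \<le> x < 3 * k\<close> one prime is, and from \<open>3 * k\<close> on at least two primes are. Hence the
  \<open>n\<close>-th Ramanujan prime can be the \<open>n\<close>-th prime only if \<open>f (2 * k) = \<pi>(2 * k) - 1 \<ge> n\<close>, and the
  \<open>(n+1)\<close>-st prime only if \<open>f (3 * k) = \<pi>(3 * k) - 2 \<ge> n\<close>. These conditions suffice if \<open>f\<close> never
  falls below \<open>f (2 * k)\<close> after \<open>2 * k\<close>, nor below \<open>f (3 * k)\<close> after \<open>3 * k\<close>. With \<open>x = k * y\<close> this
  reads \<open>\<pi>(k * y) - \<pi>(y) \<ge> \<pi>(2 * k) - 1\<close> for \<open>y \<ge> 2\<close> (\<open>prime_pi_growth_from_2\<close>) and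
  \<open>\<pi>(k * y) - \<pi>(y) \<ge> \<pi>(3 * k) - 2\<close> for \<open>y \<ge> 3\<close> (\<open>prime_pi_growth_from_3\<close>).

  The second inequality is symmetric in \<open>y\<close> and \<open>3 * k\<close>: calling the larger one \<open>u\<close> and the
  smaller one \<open>v\<close>, it says \<open>\<pi>(u) + \<pi>(v) \<le> \<pi>(u * v / 3) + 2\<close> (\<open>prime_pi_product\<close>). As
  \<open>\<pi>(v) - 2 \<le> v / 3\<close> and \<open>u \<ge> v\<close>, it is enough that there are at least \<open>sqrt (x / 3)\<close> primes
  between \<open>x / 2\<close> and \<open>x = u * v / 3\<close>, except for \<open>5 \<le> v < 7\<close>, where one prime between \<open>u\<close> and
  \<open>3/2 * u\<close> suffices. The first inequality follows from the second because there is a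
  prime between \<open>2 * k\<close> and \<open>3 * k\<close>.

  So everything rests on two statements about primes in short intervals,
  \<open>prime_between_and_three_halves\<close> and \<open>dyadic_prime_count\<close>. For large arguments both follow from
  Chebyshev's bounds \<open>0.92 * n - O(ln n) \<le> \<psi>(n) \<le> 1.2 * n + O(ln n)\<close> for
  \<open>\<psi>(n) = (\<Sum>d\<le>n. mangoldt d)\<close>, since the ratio of the two constants is less than \<open>3/2\<close>; for
  small arguments they are verified by explicit lists of primes. The bounds for \<open>\<psi>\<close> come from
  the factorial ratio \<open>(30 * m)! * m! / ((15 * m)! * (10 * m)! * (6 * m)!)\<close>.
\<close>

section \<open>Chebyshev bounds for the summatory function of the von Mangoldt function\<close>

definition chebyshev_psi :: "nat \<Rightarrow> real" where
  "chebyshev_psi n = (\<Sum>d\<in>{1..n}. mangoldt d)"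

text \<open>
  Summing \<open>ln m = (\<Sum>d dvd m. mangoldt d)\<close> over \<open>m \<le> n\<close> counts each \<open>d\<close> once for
  every multiple of it up to \<open>n\<close>.
\<close>
lemma ln_fact_eq_sum_mangoldt:
  "ln (fact n) = (\<Sum>d\<in>{1..n}. mangoldt d * real (n div d))"
proof -
  have "ln (fact n) = (\<Sum>m\<in>{1..n}. ln (real m))"
    unfolding fact_prod of_nat_prod by (rule ln_prod) auto
  also have "\<dots> = (\<Sum>m\<in>{1..n}. \<Sum>d\<in>{d\<in>{1..n}. d dvd m}. mangoldt d)"
  proof (rule sum.cong)
    fix m assume m: "m \<in> {1..n}"
    have "{d\<in>{1..n}. d dvd m} = {d. d dvd m}"
      using m by (auto dest: dvd_imp_le intro!: Nat.gr0I)
    then show "ln (real m) = (\<Sum>d\<in>{d\<in>{1..n}. d dvd m}. mangoldt d)"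
      using mangoldt_sum[of m, where 'a = real] m by simp
  qed simp
  also have "\<dots> = (\<Sum>d\<in>{1..n}. \<Sum>m\<in>{m\<in>{1..n}. d dvd m}. mangoldt d)"
    by (rule sum.swap_restrict) auto
  also have "\<dots> = (\<Sum>d\<in>{1..n}. mangoldt d * real (n div d))"
  proof (rule sum.cong)
    fix d assume d: "d \<in> {1..n}"
    have "{m\<in>{1..n}. d dvd m} = (\<lambda>i. d * i) ` {1..n div d}"
      using d by (auto simp: less_eq_div_iff_mult_less_eq mult.commute elim!: dvdE)
    moreover have "inj_on (\<lambda>i. d * i) {1..n div d}"
      using d by (auto simp: inj_on_def)
    ultimately have "card {m\<in>{1..n}. d dvd m} = n div d"
      by (simp add: card_image)
    then show "(\<Sum>m\<in>{m\<in>{1..n}. d dvd m}. mangoldt d) = mangoldt d * real (n div d)"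
      by simp
  qed simp
  finally show ?thesis .
qed

lemma ln_fact_div_eq_sum_mangoldt:
  "ln (fact (n div c)) = (\<Sum>d\<in>{1..n}. mangoldt d * real ((n div d) div c))"
proof -
  have "ln (fact (n div c)) = (\<Sum>d\<in>{1..n div c}. mangoldt d * real ((n div c) div d))"
    by (rule ln_fact_eq_sum_mangoldt)
  also have "\<dots> = (\<Sum>d\<in>{1..n}. mangoldt d * real ((n div c) div d))"
    by (rule sum.mono_neutral_left) (auto intro: order_trans[OF _ div_le_dividend])
  also have "\<dots> = (\<Sum>d\<in>{1..n}. mangoldt d * real ((n div d) div c))"
    by (simp add: div_mult2_eq [symmetric] mult.commute)
  finally show ?thesis .
qed

text \<open>
  The logarithm of Chebyshev's factorial ratio; for \<open>n = 30 * m\<close> it is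
  \<open>ln ((30 * m)! * m! / ((15 * m)! * (10 * m)! * (6 * m)!))\<close>. Because
  \<open>1 - 1/2 - 1/3 - 1/5 + 1/30 = 0\<close>, the main terms \<open>n * ln n\<close> of the factorials cancel
  and only a linear function of \<open>n\<close> is left.
\<close>
definition chebyshev_quotient :: "nat \<Rightarrow> real" where
  "chebyshev_quotient n =
     ln (fact n) - ln (fact (n div 2)) - ln (fact (n div 3)) - ln (fact (n div 5)) + ln (fact (n div 30))"

text \<open>
  The coefficient of \<open>mangoldt d\<close> in \<open>chebyshev_quotient n\<close>, with \<open>q = n div d\<close>. It is
  periodic in \<open>q\<close> with period 30, so the bounds are a finite check. That it only takes
  the values 0 and 1, and is 1 throughout \<open>1 \<le> q < 6\<close>, is the reason for the choice of
  2, 3, 5 and 30.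
\<close>
lemma chebyshev_coefficient:
  fixes q :: nat
  defines "f \<equiv> int q - int (q div 2) - int (q div 3) - int (q div 5) + int (q div 30)"
  shows "0 \<le> f" "f \<le> 1" "1 \<le> q \<Longrightarrow> q < 6 \<Longrightarrow> f = 1"
proof -
  define a r where "a = q div 30" and "r = q mod 30"
  have q: "q = r + 30 * a" and r: "r < 30"
    by (simp_all add: a_def r_def)
  have "q div 2 = r div 2 + 15 * a" 
    using div_mult_self1[of 2 r "15 * a"] by (simp add: q mult.commute)
  moreover have "q div 3 = r div 3 + 10 * a" 
    using div_mult_self1[of 3 r "10 * a"] by (simp add: q mult.commute)
  moreover have "q div 5 = r div 5 + 6 * a" 
    using div_mult_self1[of 5 r "6 * a"] by (simp add: q mult.commute)
  ultimately have f: "f = int r - int (r div 2) - int (r div 3) - int (r div 5)"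
    unfolding f_def a_def [symmetric] by (simp add: q)
  have "\<forall>r \<in> set [0..<30]. 0 \<le> int r - int (r div 2) - int (r div 3) - int (r div 5)
     \<and> int r - int (r div 2) - int (r div 3) - int (r div 5) \<le> 1"
    by (simp add: upt_rec)
  then show "0 \<le> f" "f \<le> 1" using r by (auto simp: f)
  have "\<forall>r \<in> set [1..<6]. int r - int (r div 2) - int (r div 3) - int (r div 5) + int (r div 30) = 1"
    by (simp add: upt_rec)
  then show "f = 1" if "1 \<le> q" "q < 6"
    using that by (auto simp: f_def)
qed

text \<open>
  The coefficient 1 on \<open>n div 6 < d \<le> n\<close> gives the first bound, the coefficient at most 1
  everywhere the second.
\<close>
lemma chebyshev_quotient_bounds_psi:
  "chebyshev_psi n - chebyshev_psi (n div 6) \<le> chebyshev_quotient n"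
  "chebyshev_quotient n \<le> chebyshev_psi n"
proof -
  define f :: "nat \<Rightarrow> int" where
    "f q = int q - int (q div 2) - int (q div 3) - int (q div 5) + int (q div 30)" for q
  have Q: "chebyshev_quotient n = (\<Sum>d\<in>{1..n}. mangoldt d * of_int (f (n div d)))"
    unfolding chebyshev_quotient_def ln_fact_div_eq_sum_mangoldt ln_fact_eq_sum_mangoldt[of n] f_def
    by (simp add: algebra_simps sum.distrib sum_subtractf)
  show "chebyshev_quotient n \<le> chebyshev_psi n"
    unfolding Q chebyshev_psi_def
  proof (rule sum_mono)
    fix d
    have "mangoldt d * of_int (f (n div d)) \<le> mangoldt d * (1 :: real)"
      using chebyshev_coefficient(2)[of "n div d"] unfolding f_def
      by (intro mult_left_mono) (simp_all add: mangoldt_nonneg)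
    then show "mangoldt d * of_int (f (n div d)) \<le> (mangoldt d :: real)" by simp
  qed
  have "chebyshev_psi n - chebyshev_psi (n div 6) = (\<Sum>d\<in>{1..n} - {1..n div 6}. mangoldt d)"
    unfolding chebyshev_psi_def by (subst sum_diff) auto
  also have "\<dots> = (\<Sum>d\<in>{1..n} - {1..n div 6}. mangoldt d * of_int (f (n div d)))"
  proof (rule sum.cong)
    fix d assume d: "d \<in> {1..n} - {1..n div 6}"
    then have "1 \<le> n div d" "n div d < 6"
      by (auto simp: less_eq_div_iff_mult_less_eq div_less_iff_less_mult mult.commute)
    then have "f (n div d) = 1"
      unfolding f_def by (rule chebyshev_coefficient(3))
    then show "mangoldt d = (mangoldt d * of_int (f (n div d)) :: real)" by simp
  qed simp
  also have "\<dots> \<le> chebyshev_quotient n"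
    unfolding Q
  proof (intro sum_mono2)
    fix d assume "d \<in> {1..n} - ({1..n} - {1..n div 6})"
    show "0 \<le> mangoldt d * (of_int (f (n div d)) :: real)"
      using chebyshev_coefficient(1)[of "n div d"] unfolding f_def [symmetric]
      by (intro mult_nonneg_nonneg mangoldt_nonneg) simp
  qed auto
  finally show "chebyshev_psi n - chebyshev_psi (n div 6) \<le> chebyshev_quotient n" .
qed

lemma ln_le_tangent: "a > 0 \<Longrightarrow> x > 0 \<Longrightarrow> ln x \<le> ln a + x / a - (1::real)"
  using ln_le_minus_one[of "x / a"] by (simp add: ln_div)

lemma ln_fact_Suc: "ln (fact (Suc n)) = ln (real (Suc n)) + ln (fact n :: real)"
  unfolding fact_Suc of_nat_mult by (rule ln_mult_pos) auto

lemma ln_fact_lower: "1 \<le> n \<Longrightarrow> real n * ln (real n) - real n + 1 \<le> ln (fact n)"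
proof (induction n rule: dec_induct)
  case (step n)
  have "real n * ln (real (Suc n)) \<le> real n * (ln (real n) + real (Suc n) / real n - 1)"
    using step.hyps by (intro mult_left_mono ln_le_tangent) auto
  also have "\<dots> = real n * ln (real n) + 1"
    using step.hyps by (simp add: field_simps)
  finally show ?case
    using step ln_fact_Suc[of n] by (simp add: algebra_simps)
qed simp

lemma ln_fact_upper:
  "1 \<le> n \<Longrightarrow> ln (fact n) \<le> real n * ln (real n) - real n + 1 + ln (real n)"
proof (induction n rule: dec_induct)
  case (step n)
  have "real (Suc n) * ln (real n) \<le> real (Suc n) * (ln (real (Suc n)) + real n / real (Suc n) - 1)"
    using step.hyps by (intro mult_left_mono ln_le_tangent) auto
  also have "\<dots> = real (Suc n) * ln (real (Suc n)) - 1"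
    by (simp add: field_simps)
  finally show ?case
    using step ln_fact_Suc[of n] by (simp add: algebra_simps)
qed simp

text \<open>
  Stirling's formula up to an error \<open>ln x\<close>, for the factorial of the floor \<open>n\<close> of a real
  \<open>x\<close>: moving from \<open>n\<close> to \<open>x\<close> costs at most another \<open>ln x\<close>, as \<open>x * ln x - x\<close> has the
  derivative \<open>ln x\<close>.
\<close>
lemma ln_fact_floor_bounds:
  fixes x :: real
  assumes "1 \<le> n" "real n \<le> x" "x < real n + 1"
  shows "x * ln x - x + 1 - ln x \<le> ln (fact n)"
    and "ln (fact n) \<le> x * ln x - x + 1 + ln x"
proof -
  have x: "x \<ge> 1" using assms by simp
  have "real n * ln x \<le> real n * (ln (real n) + x / real n - 1)"
    using assms by (intro mult_left_mono ln_le_tangent) auto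
  also have "\<dots> = real n * ln (real n) + x - real n"
    using assms by (simp add: field_simps)
  finally have 1: "real n * ln x \<le> real n * ln (real n) + x - real n" .
  have "(x - real n) * ln x \<le> 1 * ln x"
    using assms x by (intro mult_right_mono) auto
  with 1 ln_fact_lower[OF assms(1)] show "x * ln x - x + 1 - ln x \<le> ln (fact n)"
    by (simp add: algebra_simps)
  have "x * ln (real n) \<le> x * (ln x + real n / x - 1)"
    using assms x by (intro mult_left_mono ln_le_tangent) auto
  also have "\<dots> = x * ln x + real n - x"
    using x by (simp add: field_simps)
  finally have 2: "x * ln (real n) \<le> x * ln x + real n - x" .
  have "real n * ln (real n) \<le> x * ln (real n)"
    using assms by (intro mult_right_mono) auto
  moreover have "ln (real n) \<le> ln x"
    using assms by simp
  ultimately show "ln (fact n) \<le> x * ln x - x + 1 + ln x"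
    using 2 ln_fact_upper[OF assms(1)] by linarith
qed

lemma ln_2_3_5_bounds:
  "0.693 \<le> ln (2::real)" "ln (2::real) \<le> 0.694"
  "1.098 \<le> ln (3::real)" "ln (3::real) \<le> 1.099"
  "1.609 \<le> ln (5::real)" "ln (5::real) \<le> 1.610"
proof -
  \<comment> \<open>The series behind \<open>ln_approx_bounds\<close> converges fast for arguments near 1, hence
    the detour through \<open>3/2\<close> and \<open>5/4\<close>.\<close>
  have l2: "ln (2::real) \<in> {0.693..0.6933}"
    using ln_approx_bounds[of 2 3] by (simp add: eval_nat_numeral)
  have l32: "ln (3/2::real) \<in> {0.4053..0.4055}"
    using ln_approx_bounds[of "3/2" 2] by (simp add: eval_nat_numeral)
  have l54: "ln (5/4::real) \<in> {0.2231..0.2232}"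
    using ln_approx_bounds[of "5/4" 2] by (simp add: eval_nat_numeral)
  have 3: "ln (3::real) = ln 2 + ln (3/2)" by (simp add: ln_div)
  have "ln (4::real) = 2 * ln 2" using ln_realpow[of 2 2] by simp
  then have 5: "ln (5::real) = 2 * ln 2 + ln (5/4)" by (simp add: ln_div)
  show 
  "0.693 \<le> ln (2::real)" "ln (2::real) \<le> 0.694"
  "1.098 \<le> ln (3::real)" "ln (3::real) \<le> 1.099"
  "1.609 \<le> ln (5::real)" "ln (5::real) \<le> 1.610"
    unfolding 3 5 using l2 l32 l54 by simp_all
qed

definition chebyshev_const :: real where
  "chebyshev_const = ln 2 / 2 + ln 3 / 3 + ln 5 / 5 - ln 30 / 30"

lemma ln_30: "ln (30::real) = ln 2 + ln 3 + ln 5"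
proof -
  have "ln (2 * 3 * 5 :: real) = ln 2 + ln 3 + ln 5" by (simp only: ln_mult_pos zero_less_numeral mult_pos_pos)
  then show ?thesis by simp
qed

lemma chebyshev_const_bounds: "0.92 \<le> chebyshev_const" "chebyshev_const \<le> 0.922"
proof -
  have "chebyshev_const = (14 * ln 2 + 9 * ln 3 + 5 * ln 5) / 30"
    unfolding chebyshev_const_def ln_30 by (simp add: add_divide_distrib)
  then show "0.92 \<le> chebyshev_const" "chebyshev_const \<le> 0.922"
    using ln_2_3_5_bounds by simp_all
qed

text \<open>
  Each of the five factorials is \<open>x/c * ln (x/c) - x/c\<close> up to \<open>1 + ln (x/c)\<close>. The main terms
  add up to exactly \<open>chebyshev_const * n\<close>, the errors to less than \<open>5 * ln n\<close>.
\<close>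
lemma chebyshev_quotient_asymp:
  assumes "30 \<le> n"
  shows "\<bar>chebyshev_quotient n - chebyshev_const * real n\<bar> \<le> 5 * ln (real n)"
proof -
  define x where "x = real n"
  define g where "g c = x / c * (ln x - ln c) - x / c" for c :: real
  have x: "x \<ge> 30" using assms by (simp add: x_def)
  have bounds: "g (real d) + 1 - ln x + ln (real d) \<le> ln (fact (n div d))"
      "ln (fact (n div d)) \<le> g (real d) + 1 + ln x - ln (real d)"
    if d: "1 \<le> d" "d \<le> 30" for d
  proof -
    have "1 \<le> n div d"
      using d assms by (simp add: less_eq_div_iff_mult_less_eq)
    moreover have "real (n div d) \<le> x / real d"
      unfolding x_def by (rule of_nat_div_le_of_nat)
    moreover have "x < (real (n div d) + 1) * real d"
    proof -
      have "n < Suc (n div d) * d"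
        using d by (simp add: dividend_less_div_times)
      then have "real n < real (Suc (n div d) * d)"
        by (rule of_nat_less_iff [THEN iffD2])
      then show ?thesis by (simp add: x_def algebra_simps)
    qed
    then have "x / real d < real (n div d) + 1"
      using d by (simp add: divide_less_eq)
    moreover have "ln (x / real d) = ln x - ln (real d)"
      using x d by (simp add: ln_div)
    ultimately show "g (real d) + 1 - ln x + ln (real d) \<le> ln (fact (n div d))"
      "ln (fact (n div d)) \<le> g (real d) + 1 + ln x - ln (real d)"
      unfolding g_def using ln_fact_floor_bounds[of "n div d" "x / real d"] by simp_all
  qed
  have "g 1 - g 2 - g 3 - g 5 + g 30 = chebyshev_const * x"
    unfolding g_def chebyshev_const_def by (simp add: algebra_simps)
  then show ?thesis
    using bounds[of 1] bounds[of 2] bounds[of 3] bounds[of 5] bounds[of 30]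
      ln_2_3_5_bounds ln_30
    unfolding chebyshev_quotient_def x_def [symmetric] abs_le_iff by simp
qed

lemma chebyshev_psi_lower:
  assumes "30 \<le> n"
  shows "0.92 * real n - 5 * ln (real n) \<le> chebyshev_psi n"
proof -
  have "0.92 * real n \<le> chebyshev_const * real n"
    using chebyshev_const_bounds by (intro mult_right_mono) auto
  then show ?thesis
    using chebyshev_quotient_asymp[OF assms] chebyshev_quotient_bounds_psi(2)[of n]
    by linarith
qed

lemma chebyshev_psi_le_mult_ln: "chebyshev_psi n \<le> real n * ln (real n)"
proof -
  have "chebyshev_psi n \<le> (\<Sum>d\<in>{1..n}. ln (real n))"
    unfolding chebyshev_psi_def
  proof (rule sum_mono)
    fix d assume "d \<in> {1..n}"
    then show "mangoldt d \<le> ln (real n)"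
      using mangoldt_le[of d] by (auto intro: order_trans)
  qed
  then show ?thesis by simp
qed

text \<open>
  Iterating \<open>\<psi>(n) \<le> \<psi>(n div 6) + chebyshev_quotient n\<close> gives the factor
  \<open>6/5 * chebyshev_const\<close>, about 1.106, and an error of order \<open>(ln n)^2\<close>. Rounding the
  factor up to 1.2 leaves enough room to keep the error at \<open>10 * ln n + 30\<close>, and the
  crude bound \<open>\<psi>(n) \<le> n * ln n\<close> suffices for \<open>n < 30\<close>.
\<close>
lemma chebyshev_psi_upper:
  assumes "1 \<le> n"
  shows "chebyshev_psi n \<le> 1.2 * real n + 10 * ln (real n) + 30"
  using assms
proof (induction n rule: less_induct)
  case (less n)
  have "ln (2 ^ 3 * 3 ^ 2 :: real) = 3 * ln 2 + 2 * ln 3"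
    by (subst ln_mult_pos) (simp_all only: ln_realpow zero_less_numeral zero_less_power of_nat_numeral)
  then have ln72: "ln (72::real) \<le> 4.28" using ln_2_3_5_bounds by simp
  have ln6: "ln (6::real) = ln 2 + ln 3" using ln_mult_pos[of 2 3] by simp
  show ?case
  proof (cases "n < 30")
    case True
    have "chebyshev_psi n - 10 * ln (real n) \<le> (real n - 10) * ln (real n)"
      using chebyshev_psi_le_mult_ln[of n] by (simp add: algebra_simps)
    also have "\<dots> \<le> 1.2 * real n + 30"
    proof (cases "n \<le> 10")
      case True
      then have "(real n - 10) * ln (real n) \<le> 0"
        using less.prems by (intro mult_nonpos_nonneg) auto
      then show ?thesis by simp
    next
      case False
      have "ln (real n) \<le> ln 30" using less.prems \<open>n < 30\<close> by simp
      then have "ln (real n) \<le> 3.41" using ln_30 ln_2_3_5_bounds by simp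
      then have "(real n - 10) * ln (real n) \<le> (real n - 10) * 3.41"
        using False by (intro mult_left_mono) auto
      moreover have "real n \<le> 29" using \<open>n < 30\<close> by simp
      ultimately show ?thesis by simp
    qed
    finally show ?thesis by simp
  next
    case False
    have x: "real n \<ge> 30" using False by simp
    have m: "1 \<le> n div 6" "n div 6 < n" using False by auto
    have mle: "real (n div 6) \<le> real n / 6"
      using of_nat_div_le_of_nat[of n 6] by simp
    have "ln (real (n div 6)) \<le> ln (real n / 6)"
      using m mle by (subst ln_le_cancel_iff) auto
    also have "\<dots> = ln (real n) - ln 6" using x by (simp add: ln_div)
    finally have "chebyshev_psi (n div 6) \<le> 0.2 * real n + 10 * (ln (real n) - ln 6) + 30"
      using less.IH[OF m(2) m(1)] mle by simp
    moreover have "chebyshev_psi n \<le> chebyshev_psi (n div 6) + 0.922 * real n + 5 * ln (real n)"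
    proof -
      have "chebyshev_const * real n \<le> 0.922 * real n"
        using chebyshev_const_bounds by (intro mult_right_mono) auto
      then show ?thesis
        using chebyshev_quotient_asymp[of n] chebyshev_quotient_bounds_psi(1)[of n] False
        by linarith
    qed
    \<comment> \<open>The step needs \<open>5 * ln n \<le> 0.078 * n + 10 * ln 6\<close>. The tangent of \<open>ln\<close> at 72 has
      the slope \<open>1/72\<close>, and \<open>5/72 < 0.078\<close>.\<close>
    moreover have "ln (real n) \<le> ln 72 + real n / 72 - 1"
      using x by (intro ln_le_tangent) auto
    ultimately show ?thesis
      using ln72 ln6 ln_2_3_5_bounds x by simp
  qed
qed

text \<open>
  Group the proper prime powers by their prime \<open>p\<close>. Only \<open>p \<le> sqrt n\<close> occur, and the powers
  of one \<open>p\<close> contribute at most \<open>\<lfloor>log p n\<rfloor> * ln p \<le> ln n\<close>.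
\<close>
lemma sum_mangoldt_proper_primepow_le:
  assumes "1 \<le> n"
  shows "(\<Sum>d\<in>{d\<in>{1..n}. primepow d \<and> \<not> prime d}. mangoldt d) \<le> sqrt (real n) * ln (real n)"
proof -
  define S where "S = {d\<in>{1..n}. primepow d \<and> \<not> prime d}"
  define P where "P = {p. prime p \<and> p ^ 2 \<le> n}"
  have P_sub: "P \<subseteq> {1..nat \<lfloor>sqrt (real n)\<rfloor>}"
  proof
    fix p assume "p \<in> P"
    then have p: "prime p" "p ^ 2 \<le> n" by (auto simp: P_def)
    have "(real p)\<^sup>2 \<le> real n"
      using p(2) by (metis of_nat_le_iff of_nat_power)
    then have "real p \<le> sqrt (real n)" by (rule real_le_rsqrt)
    then show "p \<in> {1..nat \<lfloor>sqrt (real n)\<rfloor>}"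
      using prime_ge_1_nat[OF p(1)] by (simp add: le_nat_floor)
  qed
  then have fin: "finite P" by (rule finite_subset) simp
  have "card P \<le> nat \<lfloor>sqrt (real n)\<rfloor>"
    using card_mono[OF _ P_sub] by simp
  then have cardP: "real (card P) \<le> sqrt (real n)"
    by (meson of_nat_floor of_nat_le_iff order_trans real_sqrt_ge_zero of_nat_0_le_iff)
  have decomp: "\<exists>i\<ge>2. prime (aprimedivisor d) \<and> d = aprimedivisor d ^ i" if "d \<in> S" for d
  proof -
    have "primepow d" "\<not> prime d" using that by (simp_all add: S_def)
    then obtain p i where pi: "prime p" "0 < i" "d = p ^ i"
      unfolding primepow_def by blast
    have "i \<noteq> 1" using pi \<open>\<not> prime d\<close> by (metis power_one_right)
    then have "2 \<le> i" using pi(2) by simp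
    moreover have "aprimedivisor d = p"
      unfolding pi(3) using pi(1,2) by (rule aprimedivisor_prime_power)
    ultimately show ?thesis using pi by blast
  qed
  have img: "aprimedivisor ` S \<subseteq> P"
  proof
    fix p assume "p \<in> aprimedivisor ` S"
    then obtain d i where d: "d \<in> S" "prime p" "2 \<le> i" "d = p ^ i"
      using decomp by blast
    have "p ^ 2 \<le> p ^ i"
      using d(3) prime_ge_1_nat[OF d(2)] by (rule power_increasing)
    also have "\<dots> \<le> n" using d(1,4) by (simp add: S_def)
    finally show "p \<in> P" using d(2) by (simp add: P_def)
  qed
  have "(\<Sum>d\<in>S. mangoldt d) = (\<Sum>p\<in>P. \<Sum>d\<in>{d\<in>S. aprimedivisor d = p}. mangoldt d)"
    using fin img by (intro sum.group [symmetric]) (auto simp: S_def)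
  also have "\<dots> \<le> (\<Sum>p\<in>P. ln (real n))"
  proof (rule sum_mono)
    fix p assume "p \<in> P"
    then have p: "prime p" by (auto simp: P_def)
    have p1: "real p > 1" using prime_gt_1_nat[OF p] by simp
    define I where "I = nat \<lfloor>log (real p) (real n)\<rfloor>"
    have sub: "{d\<in>S. aprimedivisor d = p} \<subseteq> (\<lambda>i. p ^ i) ` {1..I}"
    proof
      fix d assume "d \<in> {d\<in>S. aprimedivisor d = p}"
      then have d: "d \<in> S" "aprimedivisor d = p" by auto
      then obtain i where i: "2 \<le> i" "d = p ^ i"
        using decomp by blast
      have "p ^ i \<le> n" using d(1) i(2) by (simp add: S_def)
      have "real i \<le> log (real p) (real n)"
        using \<open>p ^ i \<le> n\<close> p1 by (intro le_log_of_power) (simp_all only: of_nat_power [symmetric] of_nat_le_iff)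
      then have "i \<le> I" unfolding I_def by (simp add: le_nat_floor)
      with i(1) have "i \<in> {1..I}" by simp
      with i(2) show "d \<in> (\<lambda>i. p ^ i) ` {1..I}" by (rule image_eqI)
    qed
    have "(\<Sum>d\<in>{d\<in>S. aprimedivisor d = p}. mangoldt d) = (\<Sum>d\<in>{d\<in>S. aprimedivisor d = p}. ln (real p))"
      by (rule sum.cong) (auto simp: S_def mangoldt_def)
    also have "\<dots> = real (card {d\<in>S. aprimedivisor d = p}) * ln (real p)" by simp
    also have "\<dots> \<le> real I * ln (real p)"
    proof (rule mult_right_mono)
      have "card {d\<in>S. aprimedivisor d = p} \<le> card {1..I}"
        using sub by (rule surj_card_le[rotated]) simp
      then show "real (card {d\<in>S. aprimedivisor d = p}) \<le> real I" by simp
    qed (use p1 in simp)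
    also have "\<dots> \<le> log (real p) (real n) * ln (real p)"
      using p1 assms unfolding I_def by (intro mult_right_mono of_nat_floor) auto
    also have "\<dots> = ln (real n)" using p1 by (simp add: log_def)
    finally show "(\<Sum>d\<in>{d\<in>S. aprimedivisor d = p}. mangoldt d) \<le> ln (real n)" .
  qed
  also have "\<dots> = real (card P) * ln (real n)" by simp
  also have "\<dots> \<le> sqrt (real n) * ln (real n)"
    using cardP assms by (intro mult_right_mono) auto
  finally show ?thesis unfolding S_def .
qed

text \<open>
  This turns bounds for \<open>\<psi>\<close> into lower bounds for the number of primes in an interval.
\<close>
lemma chebyshev_psi_diff_le_card_primes:
  assumes "1 \<le> n" "m \<le> n"
  shows "chebyshev_psi n - chebyshev_psi m
           \<le> (real (card {p. prime p \<and> m < p \<and> p \<le> n}) + sqrt (real n)) * ln (real n)"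
proof -
  define Q where "Q = {p. prime p \<and> m < p \<and> p \<le> n}"
  define S where "S = {d\<in>{1..n}. primepow d \<and> \<not> prime d}"
  have fin: "finite Q" "finite S" by (auto simp: Q_def S_def)
  have "chebyshev_psi n - chebyshev_psi m = (\<Sum>d\<in>{1..n} - {1..m}. mangoldt d)"
    unfolding chebyshev_psi_def using assms by (subst sum_diff) auto
  also have "\<dots> = (\<Sum>d\<in>({1..n} - {1..m}) \<inter> (Q \<union> S). mangoldt d)"
    by (rule sum.mono_neutral_right) (auto simp: Q_def S_def mangoldt_def)
  also have "\<dots> \<le> (\<Sum>d\<in>Q \<union> S. mangoldt d)"
    using fin by (intro sum_mono2) (auto simp: mangoldt_nonneg)
  also have "\<dots> = (\<Sum>d\<in>Q. mangoldt d) + (\<Sum>d\<in>S. mangoldt d)"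
    using fin by (intro sum.union_disjoint) (auto simp: Q_def S_def)
  also have "(\<Sum>d\<in>Q. mangoldt d) \<le> (\<Sum>d\<in>Q. ln (real n))"
  proof (rule sum_mono)
    fix d assume "d \<in> Q"
    then have "1 \<le> d" "d \<le> n" by (auto simp: Q_def)
    then show "mangoldt d \<le> ln (real n)"
      using mangoldt_le[of d] by (auto intro: order_trans)
  qed
  also have "(\<Sum>d\<in>S. mangoldt d) \<le> sqrt (real n) * ln (real n)"
    unfolding S_def using assms(1) by (rule sum_mangoldt_proper_primepow_le)
  finally show ?thesis by (simp add: Q_def algebra_simps)
qed

section \<open>Primes between m and 3m/2, and the number of primes between n and 2n\<close>

text \<open>
  Bounds \<open>ln x\<close> linearly in \<open>sqrt x\<close>, which makes the inequalities below quadratic in \<open>sqrt n\<close>.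
\<close>
lemma ln_sqrt_le_tangent:
  assumes "a > 0" "x > 0"
  shows "ln x \<le> 2 * (ln a + sqrt x / a - 1)"
proof -
  have "ln x = 2 * ln (sqrt x)"
    using assms by (simp add: ln_sqrt)
  also have "\<dots> \<le> 2 * (ln a + sqrt x / a - 1)"
    using assms by (intro mult_left_mono ln_le_tangent) auto
  finally show ?thesis .
qed

text \<open>
  With \<open>n = 3 * m div 2\<close>, the bounds for \<open>\<psi>\<close> give \<open>\<psi>(n) - \<psi>(m) \<ge> (0.92 - 2/3 * 1.2) * n - O(ln n)\<close>.
  Without a prime in the interval only proper prime powers contribute, that is at most
  \<open>sqrt n * ln n\<close>. The two are incompatible once \<open>sqrt n \<ge> 100\<close>.
\<close>
lemma prime_gap_large:
  assumes "6700 \<le> (m::nat)"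
  shows "\<exists>p. prime p \<and> m < p \<and> 2 * p \<le> 3 * m"
proof (rule ccontr)
  assume no_prime: "\<not> ?thesis"
  define n where "n = 3 * m div 2"
  define s where "s = sqrt (real n)"
  have n: "10000 \<le> n" "m \<le> n" and m: "3 * m \<le> 2 * n + 1" 
    using assms by (auto simp: n_def)
  have "100 = sqrt (real 10000)" by (simp add: real_sqrt_eq_iff real_sqrt_unique)
  also have "\<dots> \<le> s" using n unfolding s_def by (subst real_sqrt_le_iff) simp
  finally have s: "100 \<le> s" .
  have sq: "100 * s \<le> real n"
    using mult_right_mono[of 100 s s] s by (simp add: s_def)
  have "{p. prime p \<and> m < p \<and> p \<le> n} = {}"
    using no_prime by (auto simp: n_def)
  then have no_primes: "card {p. prime p \<and> m < p \<and> p \<le> n} = 0"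
    by (simp only: card.empty)
  have "chebyshev_psi n - chebyshev_psi m \<le> s * ln (real n)"
    using chebyshev_psi_diff_le_card_primes[of n m] n unfolding no_primes s_def by simp
  moreover have "0.92 * real n - 5 * ln (real n) \<le> chebyshev_psi n"
    using n by (intro chebyshev_psi_lower) auto
  moreover have "chebyshev_psi m \<le> 1.2 * real m + 10 * ln (real m) + 30"
    using assms by (intro chebyshev_psi_upper) auto
  moreover have "1.2 * real m \<le> 0.8 * real n + 0.4"
    using m by simp
  moreover have "ln (real m) \<le> ln (real n)"
    using n assms by simp
  ultimately have "0.12 * real n \<le> (s + 15) * ln (real n) + 30.4"
    by (simp add: algebra_simps)
  also have "(s + 15) * ln (real n) \<le> (s + 15) * (7.22 + 0.02 * s)"
  proof (rule mult_left_mono)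
    have "ln (2 ^ 2 * 5 ^ 2 :: real) = 2 * ln 2 + 2 * ln 5"
      by (subst ln_mult_pos) (simp_all only: ln_realpow zero_less_numeral zero_less_power of_nat_numeral)
    then have "ln (100::real) \<le> 4.61"
      using ln_2_3_5_bounds by simp
    then show "ln (real n) \<le> 7.22 + 0.02 * s"
      using ln_sqrt_le_tangent[of 100 "real n"] n by (simp add: s_def)
  qed (use s in simp)
  also have "(s + 15) * (7.22 + 0.02 * s) = 0.02 * real n + 7.52 * s + 108.3"
    by (simp add: s_def field_simps)
  finally show False using s sq by simp
qed

lemma prime_gap_from_chain:
  assumes "list_all prime qs" "successively (\<lambda>a q. 2 * q \<le> 3 * a) (a # qs)"
    and "a \<le> m" "m < last (a # qs)"
  shows "\<exists>p. prime p \<and> m < p \<and> 2 * p \<le> 3 * (m::nat)"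
  using assms
proof (induction qs arbitrary: a)
  case (Cons q qs)
  show ?case
  proof (cases "m < q")
    case True
    then show ?thesis using Cons.prems by (intro exI[of _ q]) auto
  next
    case False
    then show ?thesis using Cons.prems by (intro Cons.IH[of q]) auto
  qed
qed simp

text \<open>
  The divisors are the primes below 89, and \<open>7921 = 89^2\<close>. Allowing \<open>d = q\<close> makes
  the criterion valid for the listed primes themselves, so that one rewrite rule covers
  all numerals below 7921.
\<close>
lemma prime_iff_trial_division:
  assumes "q < 7921"
  shows "prime (q::nat) \<longleftrightarrow> 1 < q \<and> list_all (\<lambda>d. d dvd q \<longrightarrow> d = q)
    [2, 3, 5, 7, 11, 13, 17, 19, 23, 29, 31, 37, 41, 43, 47, 53, 59, 61, 67, 71, 73, 79, 83]"
    (is "_ \<longleftrightarrow> 1 < q \<and> list_all ?P ?ds")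
proof -
  define ds where "ds = ?ds"
  have small_primes: "list_all (\<lambda>p. prime p \<longrightarrow> p \<in> set ds) [2..<89]"
    unfolding ds_def by simp
  have "list_all (\<lambda>d. d \<noteq> 1) ds" unfolding ds_def by simp
  then have "list_all ?P ds" if "prime q"
    using that unfolding list_all_iff prime_nat_iff by blast
  moreover have "1 < q" if "prime q" using that by (rule prime_gt_1_nat)
  moreover have "prime q" if q: "1 < q" "list_all ?P ds"
  proof (rule ccontr)
    assume "\<not> prime q"
    obtain p where p: "prime p" "p dvd q" "p * p \<le> q"
    proof -
      obtain a where a: "prime a" "a dvd q" using q prime_factor_nat[of q] by auto
      then obtain c where c: "q = a * c" by auto
      have "c \<noteq> 1" using c a \<open>\<not> prime q\<close> by auto
      then obtain b where b: "prime b" "b dvd c" using prime_factor_nat by blast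
      have "0 < c" using c q by (auto intro!: Nat.gr0I)
      then have "b \<le> c" using b by (auto dest: dvd_imp_le)
      then have "a * b \<le> q" using c by simp
      show ?thesis
      proof (cases "a \<le> b")
        case True
        have "a * a \<le> a * b" using True by simp
        also have "\<dots> \<le> q" by fact
        finally show ?thesis by (rule that[OF a])
      next
        case False
        have "b * b \<le> a * b" using False by simp
        also have "\<dots> \<le> q" by fact
        finally show ?thesis
          using b c by (intro that[of b]) simp_all
      qed
    qed
    have "p < 89"
    proof (rule ccontr)
      assume "\<not> p < 89"
      then have "89 * 89 \<le> p * p" by (intro mult_le_mono) auto
      also note p(3)
      also note assms
      finally show False by simp
    qed
    then have "p \<in> set ds"
      using small_primes p(1) prime_ge_2_nat[OF p(1)] unfolding list_all_iff set_upt by simp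
    with q(2) p(2) have "p = q" unfolding list_all_iff by (elim ballE) auto
    then show False using p \<open>\<not> prime q\<close> by simp
  qed
  ultimately show ?thesis unfolding ds_def by blast
qed

text \<open>
  Below the range of \<open>prime_gap_large\<close>, a chain of primes suffices in which each is at most
  \<open>3/2\<close> of its predecessor. The start at 19 is what \<open>k \<ge> 29/3\<close> requires, since then
  \<open>\<lfloor>2 * k\<rfloor> \<ge> 19\<close>.
\<close>
lemma prime_between_and_three_halves:
  assumes "19 \<le> (m::nat)"
  shows "\<exists>p. prime p \<and> m < p \<and> 2 * p \<le> 3 * m"
proof (cases "m < 7121")
  case True
  define qs :: "nat list"
    where "qs = [23, 31, 43, 61, 89, 131, 193, 283, 421, 631, 941, 1409, 2113, 3169, 4751, 7121]"
  have "list_all prime qs"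
    unfolding qs_def by (simp add: prime_iff_trial_division del: prime_nat_numeral_eq)
  moreover have "successively (\<lambda>a q. 2 * q \<le> 3 * a) (19 # qs)"
    unfolding qs_def by simp
  moreover have "last (19 # qs) = 7121"
    unfolding qs_def by simp
  ultimately show ?thesis
    using assms True by (intro prime_gap_from_chain[of qs 19 m]) simp_all
next
  case False
  then show ?thesis by (intro prime_gap_large) simp
qed

text \<open>
  Here \<open>\<psi>(2 * n) - \<psi>(n) \<ge> (0.92 - 0.6) * 2 * n - O(ln n)\<close>. If the number \<open>c\<close> of primes were
  below \<open>sqrt ((2 * n + 2) / 3)\<close>, then primes and proper prime powers together would
  contribute at most about \<open>1.578 * sqrt (2 * n) * ln (2 * n)\<close>, which is too little.
\<close>
lemma dyadic_prime_count_large: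
  assumes "1250 \<le> (n::nat)"
  shows "2 * n + 2 \<le> 3 * (card {p. prime p \<and> n < p \<and> p \<le> 2 * n})\<^sup>2"
proof (rule ccontr)
  define c where "c = card {p. prime p \<and> n < p \<and> p \<le> 2 * n}"
  define s where "s = sqrt (real (2 * n))"
  define L where "L = ln (real (2 * n))"
  assume "\<not> ?thesis"
  then have "3 * c\<^sup>2 \<le> 2 * n + 2" by (simp add: c_def)
  then have "real (3 * c\<^sup>2) \<le> real (2 * n + 2)" by (rule of_nat_mono)
  then have c: "3 * (real c)\<^sup>2 \<le> real (2 * n) + 2" by simp
  have "50 = sqrt (real 2500)" by (simp add: real_sqrt_eq_iff real_sqrt_unique)
  also have "\<dots> \<le> s" using assms unfolding s_def by (subst real_sqrt_le_iff) simp
  finally have s: "50 \<le> s" .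
  have sq: "50 * s \<le> real (2 * n)"
    using mult_right_mono[of 50 s s] s by (simp add: s_def)
  \<comment> \<open>\<open>0.578\<close> is slightly larger than \<open>1 / sqrt 3\<close>; the excess absorbs the summand 2.\<close>
  have "(real c)\<^sup>2 \<le> 0.334084 * real (2 * n)"
    using c sq s by simp
  also have "\<dots> = (0.578 * s)\<^sup>2"
    by (simp add: s_def power_mult_distrib) (simp add: power2_eq_square)
  finally have "(real c)\<^sup>2 \<le> (0.578 * s)\<^sup>2" .
  then have c_le: "real c \<le> 0.578 * s"
    by (rule power2_le_imp_le) (use s in simp)
  have L: "0 \<le> L" "L \<le> 5.84 + 0.04 * s"
  proof -
    show "0 \<le> L" using assms by (simp add: L_def)
    have "ln (2 * 5 ^ 2 :: real) = ln 2 + 2 * ln 5"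
      by (subst ln_mult_pos) (simp_all only: ln_realpow zero_less_numeral zero_less_power of_nat_numeral)
    then have "ln (50::real) \<le> 3.92"
      using ln_2_3_5_bounds by simp
    then show "L \<le> 5.84 + 0.04 * s"
      using ln_sqrt_le_tangent[of 50 "real (2 * n)"] assms by (simp add: s_def L_def)
  qed
  have "chebyshev_psi (2 * n) - chebyshev_psi n \<le> (real c + s) * L"
    using chebyshev_psi_diff_le_card_primes[of "2 * n" n] assms 
    unfolding c_def s_def L_def by simp
  moreover have "0.92 * real (2 * n) - 5 * L \<le> chebyshev_psi (2 * n)"
    using assms unfolding L_def by (intro chebyshev_psi_lower) auto
  moreover have "chebyshev_psi n \<le> 1.2 * real n + 10 * ln (real n) + 30"
    using assms by (intro chebyshev_psi_upper) auto
  moreover have "ln (real n) \<le> L"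
    using assms by (simp add: L_def)
  ultimately have "0.32 * real (2 * n) \<le> (real c + s) * L + 15 * L + 30"
    by simp
  also have "\<dots> \<le> (1.578 * s + 15) * L + 30"
    using mult_right_mono[OF c_le L(1)] by (simp add: algebra_simps)
  also have "\<dots> \<le> (1.578 * s + 15) * (5.84 + 0.04 * s) + 30"
    using s L(2) by (intro add_right_mono mult_left_mono) auto
  also have "(1.578 * s + 15) * (5.84 + 0.04 * s) = 0.06312 * real (2 * n) + 9.81552 * s + 87.6"
    by (simp add: s_def algebra_simps)
  finally show False using sq s by simp
qed

text \<open>
  A certificate for \<open>dyadic_prime_count\<close> on an initial segment. If \<open>b\<close> is the least element of
  a block \<open>ps\<close>, then for all \<open>n\<close> with \<open>a \<le> n < b\<close> the whole block lies between \<open>n\<close> and \<open>2 * n\<close>,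
  so its length bounds the number of primes there from below for all these \<open>n\<close> at once, and
  \<open>2 * n + 2 \<le> 2 * b\<close>. The next block starts from \<open>b\<close>.
\<close>
fun dyadic_blocks :: "nat \<Rightarrow> nat list list \<Rightarrow> bool" where
  "dyadic_blocks a [] \<longleftrightarrow> True"
| "dyadic_blocks a (ps # pss) \<longleftrightarrow>
     distinct ps \<and> list_all (\<lambda>p. prime p \<and> hd ps \<le> p \<and> p \<le> 2 * a) ps \<and>
     2 * hd ps \<le> 3 * (length ps)\<^sup>2 \<and> dyadic_blocks (hd ps) pss"

lemma dyadic_prime_count_from_blocks:
  assumes "dyadic_blocks a pss" "pss \<noteq> []" "a \<le> n" "n < hd (last pss)"
  shows "2 * n + 2 \<le> 3 * (card {p. prime p \<and> n < p \<and> p \<le> 2 * n})\<^sup>2"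
  using assms
proof (induction pss arbitrary: a)
  case (Cons ps pss)
  have ps: "distinct ps" "list_all (\<lambda>p. prime p \<and> hd ps \<le> p \<and> p \<le> 2 * a) ps"
    "2 * hd ps \<le> 3 * (length ps)\<^sup>2" "dyadic_blocks (hd ps) pss"
    using Cons.prems(1) by auto
  show ?case
  proof (cases "n < hd ps")
    case True
    have "set ps \<subseteq> {p. prime p \<and> n < p \<and> p \<le> 2 * n}"
      using ps(2) True \<open>a \<le> n\<close> by (auto simp: list_all_iff)
    then have "card (set ps) \<le> card {p. prime p \<and> n < p \<and> p \<le> 2 * n}"
      by (intro card_mono) auto
    then have "length ps \<le> card {p. prime p \<and> n < p \<and> p \<le> 2 * n}"
      using ps(1) by (simp add: distinct_card)
    then have "(length ps)\<^sup>2 \<le> (card {p. prime p \<and> n < p \<and> p \<le> 2 * n})\<^sup>2"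
      by (rule power_mono) simp
    then show ?thesis using ps(3) True by linarith
  next
    case False
    then have "pss \<noteq> []" using Cons.prems(4) by auto
    then show ?thesis
      using Cons.prems(4) False ps(4) by (intro Cons.IH[of "hd ps"]) auto
  qed
qed simp

text \<open>
  Each block consists of the largest primes up to \<open>2 * a\<close>; its length is chosen such that
  the covered range \<open>a \<le> n < b\<close> becomes as long as possible.
\<close>
lemma dyadic_blocks_29_1759:
  "dyadic_blocks 29 [
      [37, 41, 43, 47, 53],
      [53, 59, 61, 67, 71, 73],
      [73, 79, 83, 89, 97, 101, 103],
      [101, 103, 107, 109, 113, 127, 131, 137, 139],
      [151, 157, 163, 167, 173, 179, 181, 191, 193, 197, 199],
      [229, 233, 239, 241, 251, 257, 263, 269, 271, 277, 281, 283, 293],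
      [367, 373, 379, 383, 389, 397, 401, 409, 419, 421, 431, 433, 439, 443, 449, 457],
      [601, 607, 613, 617, 619, 631, 641, 643, 647, 653, 659, 661, 673, 677, 683, 691, 701,
       709, 719, 727, 733],
      [1019, 1021, 1031, 1033, 1039, 1049, 1051, 1061, 1063, 1069, 1087, 1091, 1093, 1097,
       1103, 1109, 1117, 1123, 1129, 1151, 1153, 1163, 1171, 1181, 1187, 1193, 1201],
      [1759, 1777, 1783, 1787, 1789, 1801, 1811, 1823, 1831, 1847, 1861, 1867, 1871, 1873,
       1877, 1879, 1889, 1901, 1907, 1913, 1931, 1933, 1949, 1951, 1973, 1979, 1987, 1993,
       1997, 1999, 2003, 2011, 2017, 2027, 2029]]"
  by (simp add: prime_iff_trial_division flip: One_nat_def del: prime_nat_numeral_eq One_nat_def)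

text \<open>
  Equivalently, there are at least \<open>sqrt ((2 * n + 2) / 3)\<close> primes between \<open>n\<close> and \<open>2 * n\<close>. The
  square root is far from the truth \<open>n / ln n\<close>, but of the right size for \<open>prime_pi_product\<close>
  and easy to certify for small \<open>n\<close>.
\<close>
lemma dyadic_prime_count:
  assumes "29 \<le> (n::nat)"
  shows "2 * n + 2 \<le> 3 * (card {p. prime p \<and> n < p \<and> p \<le> 2 * n})\<^sup>2"
proof (cases "n < 1759")
  case True
  show ?thesis
    by (rule dyadic_prime_count_from_blocks[OF dyadic_blocks_29_1759])
       (use assms True in simp_all)
next
  case False
  then show ?thesis by (intro dyadic_prime_count_large) simp
qed

section \<open>The prime counting function of a real argument\<close>

lemma finite_primes_le_real: "finite {p :: nat. prime p \<and> real p \<le> x}"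
proof (rule finite_subset)
  show "{p :: nat. prime p \<and> real p \<le> x} \<subseteq> {..nat \<lfloor>x\<rfloor>}"
    by (auto simp: le_nat_floor)
qed simp

lemma prime_pi_split:
  assumes "a \<le> b"
  shows "prime_pi b = prime_pi a + card {p. prime p \<and> a < real p \<and> real p \<le> b}"
proof -
  have "{p. prime p \<and> real p \<le> b} =
      {p. prime p \<and> real p \<le> a} \<union> {p. prime p \<and> a < real p \<and> real p \<le> b}"
    using assms by auto
  moreover have "finite {p. prime p \<and> a < real p \<and> real p \<le> b}"
    by (rule finite_subset[OF _ finite_primes_le_real[of b]]) auto
  ultimately show ?thesis
    unfolding prime_pi_def
    by (simp add: finite_primes_le_real card_Un_disjoint disjoint_iff)
qed

lemma prime_pi_mono: "a \<le> b \<Longrightarrow> prime_pi a \<le> prime_pi b"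
  using prime_pi_split[of a b] by simp

lemma prime_pi_less_of_prime:
  assumes "prime p" "a < real p" "real p \<le> b"
  shows "prime_pi a < prime_pi b"
proof -
  have "p \<in> {p. prime p \<and> a < real p \<and> real p \<le> b}" using assms by simp
  moreover have "finite {p. prime p \<and> a < real p \<and> real p \<le> b}"
    by (rule finite_subset[OF _ finite_primes_le_real[of b]]) auto
  ultimately have "0 < card {p. prime p \<and> a < real p \<and> real p \<le> b}"
    by (metis card_gt_0_iff empty_iff)
  then show ?thesis using prime_pi_split[of a b] assms by simp
qed

lemma prime_pi_small:
  shows "x < 2 \<Longrightarrow> prime_pi x = 0" and "2 \<le> x \<Longrightarrow> x < 3 \<Longrightarrow> prime_pi x = 1"
    and "3 \<le> x \<Longrightarrow> x < 5 \<Longrightarrow> prime_pi x = 2" and "5 \<le> x \<Longrightarrow> x < 7 \<Longrightarrow> prime_pi x = 3"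
proof -
  have primes: "{p :: nat. prime p \<and> real p \<le> x} = {p \<in> {2, 3, 5}. real p \<le> x}" if "x < 7"
  proof -
    have "p \<in> {2, 3, 5}" if "prime p" "real p \<le> x" for p
    proof -
      have "p < 7" using \<open>x < 7\<close> that(2) by linarith
      then have "p \<in> {0, 1, 2, 3, 4, 5, 6}" by auto
      then show ?thesis using that(1) by auto
    qed
    then show ?thesis by auto
  qed
  have split: "{p \<in> {2, 3, 5 :: nat}. real p \<le> x} =
    (if 2 \<le> x then {2} else {}) \<union> (if 3 \<le> x then {3} else {}) \<union> (if 5 \<le> x then {5} else {})"
    by auto
  have pi: "prime_pi x =
    card ((if 2 \<le> x then {2} else {}) \<union> (if 3 \<le> x then {3} else {}) \<union> (if 5 \<le> x then {5 :: nat} else {}))"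
    if "x < 7"
    unfolding prime_pi_def primes[OF that] split ..
  show "x < 2 \<Longrightarrow> prime_pi x = 0" and "2 \<le> x \<Longrightarrow> x < 3 \<Longrightarrow> prime_pi x = 1"
    and "3 \<le> x \<Longrightarrow> x < 5 \<Longrightarrow> prime_pi x = 2" and "5 \<le> x \<Longrightarrow> x < 7 \<Longrightarrow> prime_pi x = 3"
    by (simp_all add: pi)
qed

text \<open>
  All primes greater than 3 are congruent to 1 or 5 modulo 6, so \<open>p \<mapsto> p div 3\<close> maps them
  injectively to positive integers.
\<close>
lemma prime_pi_le_third: "0 \<le> v \<Longrightarrow> real (prime_pi v) \<le> v / 3 + 2"
proof -
  assume v: "0 \<le> v"
  define Q where "Q = {p. prime p \<and> 3 < real p \<and> real p \<le> v}"
  have "inj_on (\<lambda>p. p div 3) Q"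
  proof (rule inj_onI)
    fix p q assume "p \<in> Q" "q \<in> Q" and eq: "p div 3 = q div 3"
    have *: "\<not> 2 dvd r \<and> \<not> 3 dvd r" if "r \<in> Q" for r
    proof -
      have "prime r" "3 < r" using that by (auto simp: Q_def)
      then show ?thesis
        using primes_dvd_imp_eq[of 2 r] primes_dvd_imp_eq[of 3 r] by auto
    qed
    show "p = q" using *[OF \<open>p \<in> Q\<close>] *[OF \<open>q \<in> Q\<close>] eq by presburger
  qed
  moreover have "(\<lambda>p. p div 3) ` Q \<subseteq> {1..nat \<lfloor>v / 3\<rfloor>}"
  proof
    fix j assume "j \<in> (\<lambda>p. p div 3) ` Q"
    then obtain p where p: "3 < p" "real p \<le> v" "j = p div 3" by (auto simp: Q_def)
    have "real j \<le> v / 3"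
      using of_nat_div_le_of_nat[of p 3] p by simp
    then have "j \<le> nat \<lfloor>v / 3\<rfloor>" by (rule le_nat_floor)
    moreover have "1 \<le> j" unfolding p(3) using p(1) by simp
    ultimately show "j \<in> {1..nat \<lfloor>v / 3\<rfloor>}" by simp
  qed
  ultimately have "card Q \<le> nat \<lfloor>v / 3\<rfloor>"
    using card_inj_on_le[of "\<lambda>p. p div 3" Q "{1..nat \<lfloor>v / 3\<rfloor>}"] by simp
  then have "real (card Q) \<le> real (nat \<lfloor>v / 3\<rfloor>)"
    by (rule of_nat_mono)
  also have "\<dots> \<le> v / 3"
    using v by (intro of_nat_floor) simp
  finally have "real (card Q) \<le> v / 3" .
  moreover have "prime_pi v \<le> 2 + card Q"
  proof (cases "3 \<le> v")
    case True
    then show ?thesis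
      using prime_pi_split[of 3 v] prime_pi_small(3)[of 3] by (simp add: Q_def)
  next
    case False
    then show ?thesis using prime_pi_mono[of v 3] prime_pi_small(3)[of 3] by simp
  qed
  ultimately show ?thesis by linarith
qed

lemma prime_pi_three_halves:
  assumes "19 \<le> x" "3 / 2 * x \<le> y"
  shows "prime_pi x < prime_pi y"
proof -
  have m: "19 \<le> nat \<lfloor>x\<rfloor>" using assms by (simp add: le_nat_floor)
  obtain p where p: "prime p" "nat \<lfloor>x\<rfloor> < p" "2 * p \<le> 3 * nat \<lfloor>x\<rfloor>"
    using prime_between_and_three_halves[OF m] by blast
  have "x < real p" using p(2) assms by linarith
  moreover have "real p \<le> y"
  proof -
    have "real (2 * p) \<le> real (3 * nat \<lfloor>x\<rfloor>)" using p(3) by (rule of_nat_mono)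
    moreover have "real (nat \<lfloor>x\<rfloor>) \<le> x" using assms by (intro of_nat_floor) simp
    ultimately show ?thesis using assms(2) unfolding of_nat_mult of_nat_numeral by linarith
  qed
  ultimately show ?thesis using p(1) by (intro prime_pi_less_of_prime)
qed

lemma prime_pi_dyadic:
  assumes "58 \<le> x"
  shows "x \<le> 3 * (real (prime_pi x) - real (prime_pi (x / 2)))\<^sup>2"
proof -
  define n where "n = nat \<lfloor>x / 2\<rfloor>"
  have n: "29 \<le> n" "real n \<le> x / 2" "x / 2 < real n + 1"
    using assms unfolding n_def by (auto simp: le_nat_floor) linarith+
  define C where "C = {p. prime p \<and> x / 2 < real p \<and> real p \<le> x}"
  have "card {p. prime p \<and> n < p \<and> p \<le> 2 * n} \<le> card C"
  proof (rule card_mono)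
    show "finite C"
      unfolding C_def by (rule finite_subset[OF _ finite_primes_le_real[of x]]) auto
    show "{p. prime p \<and> n < p \<and> p \<le> 2 * n} \<subseteq> C"
      using n by (auto simp: C_def)
  qed
  then have "(card {p. prime p \<and> n < p \<and> p \<le> 2 * n})\<^sup>2 \<le> (card C)\<^sup>2"
    by (rule power_mono) simp
  then have "2 * n + 2 \<le> 3 * (card C)\<^sup>2"
    using dyadic_prime_count[OF n(1)] by linarith
  then have "real (2 * n + 2) \<le> real (3 * (card C)\<^sup>2)"
    by (rule of_nat_mono)
  moreover have "real (card C) = real (prime_pi x) - real (prime_pi (x / 2))"
    using prime_pi_split[of "x / 2" x] assms by (simp add: C_def)
  ultimately show ?thesis using n by simp
qed

section \<open>A product inequality for the prime counting function\<close>

text \<open>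
  For \<open>v < 7\<close> this is one prime between \<open>u\<close> and \<open>5/3 * u\<close>. For \<open>v \<ge> 7\<close> let \<open>x = u * v / 3\<close>.
  Then \<open>u \<le> x / 2\<close>, so it suffices to find \<open>\<pi>(v) - 2\<close> primes between \<open>x / 2\<close> and \<open>x\<close>. There
  are at least \<open>sqrt (x / 3) = sqrt (u * v) / 3\<close>, which is at least \<open>v / 3 \<ge> \<pi>(v) - 2\<close>.
\<close>
lemma prime_pi_product:
  assumes "29 \<le> u" "5 \<le> v" "v \<le> u"
  shows "prime_pi u + prime_pi v \<le> prime_pi (u * v / 3) + 2"
proof (cases "v < 7")
  case True
  have "u * 5 \<le> u * v" using assms by (intro mult_left_mono) auto
  then have "prime_pi u < prime_pi (u * v / 3)"
    using assms by (intro prime_pi_three_halves) auto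
  then show ?thesis using prime_pi_small(4)[of v] True assms by simp
next
  case False
  define x where "x = u * v / 3"
  have "u * 7 \<le> u * v" using assms False by (intro mult_left_mono) auto
  then have x: "2 * u \<le> x" using assms by (simp add: x_def)
  define d where "d = real (prime_pi x) - real (prime_pi (x / 2))"
  have "0 \<le> d" using prime_pi_mono[of "x / 2" x] x assms by (simp add: d_def)
  have "v * v \<le> u * v" using assms by (intro mult_right_mono) auto
  also have "\<dots> = 3 * x" by (simp add: x_def)
  also have "x \<le> 3 * d\<^sup>2"
    unfolding d_def using x assms by (intro prime_pi_dyadic) simp
  finally have "v\<^sup>2 \<le> (3 * d)\<^sup>2" by (simp add: power2_eq_square)
  then have "v \<le> 3 * d" by (rule power2_le_imp_le) (use \<open>0 \<le> d\<close> in simp)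
  moreover have "real (prime_pi u) \<le> real (prime_pi (x / 2))"
    using x by (intro of_nat_mono prime_pi_mono) simp
  moreover have "real (prime_pi v) \<le> v / 3 + 2"
    using assms by (intro prime_pi_le_third) simp
  ultimately have "real (prime_pi u + prime_pi v) \<le> real (prime_pi x + 2)"
    by (simp add: d_def)
  then show ?thesis unfolding x_def by (simp only: of_nat_le_iff)
qed

text \<open>
  \<open>prime_pi_product\<close> for the two numbers \<open>3 * k\<close> and \<open>y\<close>, in whichever order their sizes
  demand. This form says that \<open>\<pi>(x) - \<pi>(x / k)\<close> is at least its value at \<open>3 * k\<close> for all
  \<open>x \<ge> 3 * k\<close>.
\<close>
lemma prime_pi_growth_from_3:
  assumes "29 / 3 \<le> k" "3 \<le> y"
  shows "prime_pi (3 * k) + prime_pi y \<le> prime_pi (k * y) + 2"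
proof (cases "y < 5")
  case True
  have "prime_pi (3 * k) \<le> prime_pi (k * y)"
    using assms by (intro prime_pi_mono) (simp add: mult.commute)
  then show ?thesis using prime_pi_small(3)[of y] True assms by simp
next
  case False
  show ?thesis
  proof (cases "y \<le> 3 * k")
    case True
    have "3 * k * y / 3 = k * y" by simp
    moreover have "prime_pi (3 * k) + prime_pi y \<le> prime_pi (3 * k * y / 3) + 2"
      using assms True False by (intro prime_pi_product) auto
    ultimately show ?thesis by simp
  next
    case False
    have "prime_pi y + prime_pi (3 * k) \<le> prime_pi (y * (3 * k) / 3) + 2"
      using assms False by (intro prime_pi_product) auto
    moreover have "y * (3 * k) / 3 = k * y" by simp
    ultimately show ?thesis by simp
  qed
qed

text \<open>
  Between \<open>2 * k\<close> and \<open>3 * k\<close> there is a prime, so \<open>\<pi>(3 * k) - 2 \<ge> \<pi>(2 * k) - 1\<close> and the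
  previous lemma applies for \<open>y \<ge> 3\<close>.
\<close>
lemma prime_pi_growth_from_2:
  assumes "29 / 3 \<le> k" "2 \<le> y"
  shows "prime_pi (2 * k) + prime_pi y \<le> prime_pi (k * y) + 1"
proof (cases "y < 3")
  case True
  have "prime_pi (2 * k) \<le> prime_pi (k * y)"
    using assms by (intro prime_pi_mono) (simp add: mult.commute)
  then show ?thesis using prime_pi_small(2)[of y] True assms by simp
next
  case False
  have "prime_pi (2 * k) < prime_pi (3 * k)"
    using assms by (intro prime_pi_three_halves) auto
  moreover have "prime_pi (3 * k) + prime_pi y \<le> prime_pi (k * y) + 2"
    using assms False by (intro prime_pi_growth_from_3) auto
  ultimately show ?thesis by linarith
qed

section \<open>The n-th prime and the n-th Ramanujan prime\<close>

text \<open>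
  The Galois connection between \<open>nth_prime\<close> and \<open>prime_pi\<close>, through which the enumeration
  of the primes enters the proof.
\<close>
lemma nth_prime_le_iff:
  assumes "1 \<le> n"
  shows "real (nth_prime n) \<le> x \<longleftrightarrow> n \<le> prime_pi x"
proof -
  let ?e = "enumerate {p :: nat. prime p}"
  have inf: "infinite {p :: nat. prime p}" by (rule primes_infinite)
  have inj: "inj ?e" using strict_mono_enumerate[OF inf] by (rule strict_mono_imp_inj_on)
  have range: "range ?e = {p. prime p}" using range_enumerate[OF inf] .
  show ?thesis
  proof
    assume le: "real (nth_prime n) \<le> x"
    have "?e ` {..<n} \<subseteq> {p. prime p \<and> real p \<le> x}"
    proof
      fix p assume "p \<in> ?e ` {..<n}"
      then obtain i where i: "i < n" "p = ?e i" by blast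
      have "?e i \<le> ?e (n - 1)"
        using i(1) enumerate_mono_le_iff[OF inf] by simp
      then have "real p \<le> x" using le i(2) unfolding nth_prime_def by linarith
      moreover have "prime p" using range i(2) by blast
      ultimately show "p \<in> {p. prime p \<and> real p \<le> x}" by simp
    qed
    then have "card (?e ` {..<n}) \<le> prime_pi x"
      unfolding prime_pi_def by (intro card_mono finite_primes_le_real)
    moreover have "card (?e ` {..<n}) = n"
      using card_image[OF inj_on_subset[OF inj subset_UNIV], of "{..<n}"] by simp
    ultimately show "n \<le> prime_pi x" by simp
  next
    assume n: "n \<le> prime_pi x"
    show "real (nth_prime n) \<le> x"
    proof (rule ccontr)
      assume less: "\<not> real (nth_prime n) \<le> x"
      have "{p. prime p \<and> real p \<le> x} \<subseteq> ?e ` {..<n - 1}"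
      proof
        fix p assume p: "p \<in> {p. prime p \<and> real p \<le> x}"
        then obtain i where i: "p = ?e i" using range by blast
        have "real p \<le> x" using p by simp
        then have "?e i < ?e (n - 1)" using less i unfolding nth_prime_def by linarith
        then have "i < n - 1"
          using enumerate_mono_iff[OF inf] by simp
        then show "p \<in> ?e ` {..<n - 1}" using i by blast
      qed
      then have "prime_pi x \<le> card (?e ` {..<n - 1})"
        unfolding prime_pi_def by (intro card_mono) auto
      also have "\<dots> \<le> n - 1" using card_image_le[of "{..<n - 1}" ?e] by simp
      finally show False using n assms by simp
    qed
  qed
qed

lemma prime_pi_nth_prime: 
  assumes "1 \<le> n"
  shows "prime_pi (real (nth_prime n)) = n"
proof -
  have "n \<le> prime_pi (real (nth_prime n))"
    using nth_prime_le_iff[OF assms, of "real (nth_prime n)"] by simp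
  moreover have "\<not> n + 1 \<le> prime_pi (real (nth_prime n))"
  proof -
    have "nth_prime n < nth_prime (n + 1)"
      using assms enumerate_step[OF primes_infinite, of "n - 1"] by (simp add: nth_prime_def)
    then show ?thesis using nth_prime_le_iff[of "n + 1" "real (nth_prime n)"] by simp
  qed
  ultimately show ?thesis by simp
qed

definition ramanujan_bound :: "real \<Rightarrow> nat \<Rightarrow> nat \<Rightarrow> bool" where
  "ramanujan_bound k n m \<longleftrightarrow> 1 \<le> m \<and> (\<forall>x\<ge>real m. n + prime_pi (x / k) \<le> prime_pi x)"

lemma ramanujan_boundD:
  "ramanujan_bound k n m \<Longrightarrow> real m \<le> x \<Longrightarrow> n + prime_pi (x / k) \<le> prime_pi x"
  by (simp add: ramanujan_bound_def)

lemma ramanujan_prime_eq_Least: "ramanujan_prime k n = (LEAST m. ramanujan_bound k n m)"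
proof -
  have "int n \<le> int a - int b \<longleftrightarrow> n + b \<le> a" for a b by linarith
  then show ?thesis unfolding ramanujan_prime_def ramanujan_bound_def by simp
qed

text \<open>
  Without this the least number in \<open>ramanujan_prime\<close> would be arbitrary, and an equation
  \<open>ramanujan_prime k n = nth_prime j\<close> would carry no information.
\<close>
lemma ramanujan_bound_exists:
  assumes "2 \<le> k"
  shows "\<exists>m. ramanujan_bound k n m"
proof
  define m where "m = max 58 (3 * n\<^sup>2)"
  show "ramanujan_bound k n m"
    unfolding ramanujan_bound_def
  proof (intro conjI allI impI)
    show "m \<ge> 1" by (simp add: m_def)
    fix x :: real assume x: "x \<ge> real m"
    then have x58: "58 \<le> x" and x3: "3 * (real n)\<^sup>2 \<le> x"
      by (simp_all add: m_def of_nat_max)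
    define d where "d = real (prime_pi x) - real (prime_pi (x / 2))"
    have "(real n)\<^sup>2 \<le> d\<^sup>2"
      using prime_pi_dyadic[OF x58] x3 unfolding d_def by linarith
    moreover have "0 \<le> d" using prime_pi_mono[of "x / 2" x] x58 by (simp add: d_def)
    ultimately have "real n \<le> d" by (rule power2_le_imp_le)
    moreover have "prime_pi (x / k) \<le> prime_pi (x / 2)"
      using assms x58 by (intro prime_pi_mono divide_left_mono) auto
    ultimately show "n + prime_pi (x / k) \<le> prime_pi x"
      unfolding d_def by linarith
  qed
qed

lemma ramanujan_bound_ramanujan_prime:
  assumes "2 \<le> k"
  shows "ramanujan_bound k n (ramanujan_prime k n)"
  unfolding ramanujan_prime_eq_Least using ramanujan_bound_exists[OF assms] by (rule LeastI_ex)

text \<open>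
  For \<open>j = 0\<close>, \<open>a = 2\<close> and \<open>j = 1\<close>, \<open>a = 3\<close> this gives the upper bounds on \<open>n\<close> in the two parts
  of the theorem. If the prime \<open>q\<close> with index \<open>n + j\<close> is at most \<open>a * k\<close>, use the bound at
  \<open>x = a * k\<close>. Otherwise \<open>q / k > a\<close>, hence \<open>\<pi>(q) - \<pi>(q / k) \<le> n + j - (j + 1) < n\<close>.
\<close>
lemma ramanujan_bound_nth_prime_leD:
  assumes "ramanujan_bound k n (nth_prime (n + j))" "1 \<le> n" "0 < k"
    and "prime_pi a = j + 1"
  shows "n + prime_pi a \<le> prime_pi (a * k)"
proof -
  define q where "q = nth_prime (n + j)"
  have *: "n + prime_pi (x / k) \<le> prime_pi x" if "real q \<le> x" for x
    using assms(1) that unfolding q_def by (rule ramanujan_boundD)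
  have "real q \<le> a * k"
  proof (rule ccontr)
    assume "\<not> real q \<le> a * k"
    then have "prime_pi a \<le> prime_pi (real q / k)"
      using assms(3) by (intro prime_pi_mono) (simp add: field_simps)
    then show False
      using *[of "real q"] prime_pi_nth_prime[of "n + j"] assms(2,4) unfolding q_def by simp
  qed
  then show ?thesis using *[of "a * k"] assms(3) by simp
qed

theorem corollary3p15:
  fixes k :: real and n :: nat
  assumes "k \<ge> 29 / 3" and "n \<ge> 1"
  shows "(ramanujan_prime k n = nth_prime n \<longleftrightarrow>
            1 \<le> n \<and> int n \<le> int (prime_pi (2 * k)) - 1) \<and>
         (ramanujan_prime k n = nth_prime (n + 1) \<longleftrightarrow>
            int (prime_pi (2 * k)) \<le> int n \<and> int n \<le> int (prime_pi (3 * k)) - 2)"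
proof -
  have k: "2 \<le> k" "0 < k" using assms by auto
  have R: "ramanujan_bound k n (ramanujan_prime k n)"
    using k(1) by (rule ramanujan_bound_ramanujan_prime)
  have upper_i: "n + 1 \<le> prime_pi (2 * k)" if "ramanujan_prime k n = nth_prime n"
    using ramanujan_bound_nth_prime_leD[of k n 0 2] R that k assms prime_pi_small(2)[of 2] by simp
  have upper_ii: "n + 2 \<le> prime_pi (3 * k)" if "ramanujan_prime k n = nth_prime (n + 1)"
    using ramanujan_bound_nth_prime_leD[of k n 1 3] R that k assms prime_pi_small(3)[of 3] by simp
  have nth_pos: "1 \<le> nth_prime j" if "1 \<le> j" for j
    using prime_pi_nth_prime[OF that] prime_pi_small(1)[of 0] that
    by (cases "nth_prime j") auto
  have lower_i: "ramanujan_prime k n = nth_prime n" if n: "n + 1 \<le> prime_pi (2 * k)"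
    unfolding ramanujan_prime_eq_Least
  proof (rule Least_equality)
    have "n + prime_pi (x / k) \<le> prime_pi x" if x: "real (nth_prime n) \<le> x" for x
    proof (cases "x / k < 2")
      case True
      then show ?thesis
        using prime_pi_small(1)[of "x / k"] nth_prime_le_iff[OF assms(2)] x by simp
    next
      case False
      then show ?thesis
        using prime_pi_growth_from_2[of k "x / k"] n assms k by simp
    qed
    then show "ramanujan_bound k n (nth_prime n)"
      using nth_pos[OF assms(2)] unfolding ramanujan_bound_def by simp
  next
    fix m assume "ramanujan_bound k n m"
    then have "n + prime_pi (real m / k) \<le> prime_pi (real m)"
      by (rule ramanujan_boundD) simp
    then have "real (nth_prime n) \<le> real m"
      using nth_prime_le_iff[OF assms(2), of "real m"] by simp
    then show "nth_prime n \<le> m" by simp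
  qed
  have lower_ii: "ramanujan_prime k n = nth_prime (n + 1)"
    if n: "prime_pi (2 * k) \<le> n" "n + 2 \<le> prime_pi (3 * k)"
    unfolding ramanujan_prime_eq_Least
  proof (rule Least_equality)
    have "n + prime_pi (x / k) \<le> prime_pi x" if x: "real (nth_prime (n + 1)) \<le> x" for x
    proof (cases "x / k < 3")
      case True
      then have "prime_pi (x / k) \<le> 1"
        using prime_pi_small(1,2)[of "x / k"] by (cases "x / k < 2") auto
      then show ?thesis
        using nth_prime_le_iff[of "n + 1" x] x by simp
    next
      case False
      then show ?thesis
        using prime_pi_growth_from_3[of k "x / k"] n assms k by simp
    qed
    then show "ramanujan_bound k n (nth_prime (n + 1))"
      using nth_pos[of "n + 1"] unfolding ramanujan_bound_def by simp
  next
    fix m assume m: "ramanujan_bound k n m"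
    \<comment> \<open>If \<open>m\<close> were below the prime with index \<open>n + 1\<close>, then so would be \<open>x\<close>, because that
      prime exceeds \<open>2 * k\<close>. But from \<open>2 * k\<close> on the prime 2 is lost to \<open>\<pi>(x / k)\<close>, so that
      \<open>\<pi>(x) - \<pi>(x / k) \<ge> n\<close> needs \<open>n + 1\<close> primes up to \<open>x\<close>.\<close>
    define x where "x = max (real m) (2 * k)"
    have "n + prime_pi (x / k) \<le> prime_pi x"
      using m by (rule ramanujan_boundD) (simp add: x_def)
    moreover have "1 \<le> prime_pi (x / k)"
      using prime_pi_mono[of 2 "x / k"] prime_pi_small(2)[of 2] k
      by (simp add: x_def le_divide_eq)
    ultimately have "real (nth_prime (n + 1)) \<le> x"
      using nth_prime_le_iff[of "n + 1" x] by simp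
    moreover have "\<not> real (nth_prime (n + 1)) \<le> 2 * k"
      using nth_prime_le_iff[of "n + 1" "2 * k"] n by simp
    ultimately show "nth_prime (n + 1) \<le> m" by (simp add: x_def le_max_iff_disj)
  qed
  have distinct: "nth_prime n \<noteq> nth_prime (n + 1)"
    using prime_pi_nth_prime[of n] prime_pi_nth_prime[of "n + 1"] assms(2) by auto
  have "ramanujan_prime k n = nth_prime n \<longleftrightarrow> n + 1 \<le> prime_pi (2 * k)"
    using upper_i lower_i by blast
  moreover have "ramanujan_prime k n = nth_prime (n + 1) \<longleftrightarrow>
      prime_pi (2 * k) \<le> n \<and> n + 2 \<le> prime_pi (3 * k)"
  proof
    assume eq: "ramanujan_prime k n = nth_prime (n + 1)"
    have "\<not> n + 1 \<le> prime_pi (2 * k)"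
      using lower_i eq distinct by metis
    then show "prime_pi (2 * k) \<le> n \<and> n + 2 \<le> prime_pi (3 * k)"
      using upper_ii[OF eq] by linarith
  qed (use lower_ii in blast)
  moreover have "int n \<le> int a - 1 \<longleftrightarrow> n + 1 \<le> a" "int n \<le> int a - 2 \<longleftrightarrow> n + 2 \<le> a" for a
    by linarith+
  ultimately show ?thesis using assms(2) by (simp only: of_nat_le_iff) simp
qed

end
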